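(* Let $v$ be a valuation on a field $F$ with valuation ring $O_v$, and let $R\supseteq O_v$ be a commutative ring that is quasi-integral over $O_v$. Then $R$ satisfies INC over $O_v$: whenever $Q_0\subsetneq Q_1$ are prime ideals of $R$, one has $Q_0\cap O_v\subsetneq Q_1\cap O_v$.
   Context: For rings $C\subseteq R$, $R$ is called quasi-integral over $C$ if for every $r\in R$ there exist $m\geq 0$ and $c_0,\dots,c_m\in C$ with $\sum_{i=0}^m c_ir^i=0$ and $c_{i_0}=1$ for some index $i_0$ (depending on $r$). *)

theory Defs
  imports "HOL-Algebra.Algebra" "HOL-Library.Extended"
begin

text \<open>
  The value group is an arbitrary totally ordered abelian group \<open>'g\<close>; values live in
  \<open>'g extended\<close>, where the extra element \<open>-\<infinity>\<close> of that type is excluded by \<open>no_Minf\<close>.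
\<close>

locale valuation = field F for F (structure) +
  fixes v :: "'a \<Rightarrow> 'g::linordered_ab_group_add extended"
  assumes no_Minf: "x \<in> carrier F \<Longrightarrow> v x \<noteq> Minf"
    and infinite_iff: "x \<in> carrier F \<Longrightarrow> v x = Pinf \<longleftrightarrow> x = \<zero>"
    and val_mult: "\<lbrakk>x \<in> carrier F; y \<in> carrier F\<rbrakk> \<Longrightarrow> v (x \<otimes> y) = v x + v y"
    and val_add: "\<lbrakk>x \<in> carrier F; y \<in> carrier F\<rbrakk> \<Longrightarrow> min (v x) (v y) \<le> v (x \<oplus> y)"

definition valuation_ring ::
    "('a, 'm) ring_scheme \<Rightarrow> ('a \<Rightarrow> 'g::linordered_ab_group_add extended) \<Rightarrow> ('a, 'm) ring_scheme"
  where "valuation_ring F v = F\<lparr>carrier := {x \<in> carrier F. 0 \<le> v x}\<rparr>"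

text \<open>
  An inclusion of rings with common unit. Both rings are records over one type, but need share
  their operations only on the smaller carrier: elements of \<open>R\<close> outside \<open>C\<close> are unrelated to any
  other ring (such as a field) containing \<open>C\<close>.
\<close>

definition ring_extension :: "('a, 'm) ring_scheme \<Rightarrow> ('a, 'n) ring_scheme \<Rightarrow> bool"
  where "ring_extension C R \<longleftrightarrow>
    ring C \<and> ring R \<and> carrier C \<subseteq> carrier R \<and> (\<lambda>x. x) \<in> ring_hom C R"

definition quasi_integral :: "('a, 'm) ring_scheme \<Rightarrow> ('a, 'n) ring_scheme \<Rightarrow> bool"
  where "quasi_integral C R \<longleftrightarrow>
    (\<forall>r \<in> carrier R. \<exists>(m::nat) (c::nat \<Rightarrow> 'a).
        (\<forall>i\<le>m. c i \<in> carrier C) \<and>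
        (\<Oplus>\<^bsub>R\<^esub>i\<in>{..m}. c i \<otimes>\<^bsub>R\<^esub> r [^]\<^bsub>R\<^esub> i) = \<zero>\<^bsub>R\<^esub> \<and>
        (\<exists>i0\<le>m. c i0 = \<one>\<^bsub>C\<^esub>))"

definition satisfies_INC :: "('a, 'm) ring_scheme \<Rightarrow> ('a, 'n) ring_scheme \<Rightarrow> bool"
  where "satisfies_INC C R \<longleftrightarrow>
    (\<forall>Q0 Q1. primeideal Q0 R \<and> primeideal Q1 R \<and> Q0 \<subset> Q1 \<longrightarrow>
        Q0 \<inter> carrier C \<subset> Q1 \<inter> carrier C)"

context valuation
begin

lemma val_one: "v \<one> = 0"
proof -
  obtain g where g: "v \<one> = Fin g"
    using no_Minf[of \<one>] infinite_iff[of \<one>] by (cases "v \<one>") auto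
  have "v \<one> = v \<one> + v \<one>" using val_mult[of \<one> \<one>] by simp
  then show ?thesis using g by (simp add: zero_extended_def)
qed

lemma val_minus_one: "v (\<ominus> \<one>) = 0"
proof -
  have nz: "\<ominus> \<one> \<noteq> \<zero>" by (metis minus_minus minus_zero one_closed one_not_zero)
  obtain g where g: "v (\<ominus> \<one>) = Fin g"
    using no_Minf[of "\<ominus> \<one>"] infinite_iff[of "\<ominus> \<one>"] nz by (cases "v (\<ominus> \<one>)") auto
  have "(\<ominus> \<one>) \<otimes> (\<ominus> \<one>) = \<one>" by (simp add: l_minus)
  then have "v (\<ominus> \<one>) + v (\<ominus> \<one>) = 0" using val_mult[of "\<ominus> \<one>" "\<ominus> \<one>"] val_one by simp
  then show ?thesis using g by (simp add: zero_extended_def)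
qed

lemma valuation_ring_subring: "subring (carrier (valuation_ring F v)) F"
proof (rule subringI)
  fix x assume x: "x \<in> carrier (valuation_ring F v)"
  then have "v (\<ominus> x) = v x"
    using val_mult[of "\<ominus> \<one>" x] val_minus_one by (simp add: valuation_ring_def l_minus)
  then show "\<ominus> x \<in> carrier (valuation_ring F v)" using x by (simp add: valuation_ring_def)
next
  fix x y assume "x \<in> carrier (valuation_ring F v)" "y \<in> carrier (valuation_ring F v)"
  then show "x \<otimes> y \<in> carrier (valuation_ring F v)" "x \<oplus> y \<in> carrier (valuation_ring F v)"
    using val_mult[of x y] val_add[of x y] add_mono[of 0 "v x" 0 "v y"]
    by (auto simp: valuation_ring_def min_def split: if_splits)
qed (auto simp: valuation_ring_def val_one)

lemma valuation_ring_cring: "cring (valuation_ring F v)"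
  using subcring_iff[of "carrier (valuation_ring F v)"] valuation_ring_subring
    subcringI'[of "carrier (valuation_ring F v)"]
  by (auto simp: valuation_ring_def)

end

end

theory Submission
  imports Defs
begin

text \<open>
  If \<open>Q\<^sub>0 \<subset> Q\<^sub>1\<close> had the same trace on \<open>C\<close>, take \<open>r \<in> Q\<^sub>1 - Q\<^sub>0\<close> and a relation \<open>\<Sum> c\<^sub>i r\<^sup>i = 0\<close> with
  some \<open>c\<^sub>i = 1\<close>. Modulo \<open>Q\<^sub>1\<close> only \<open>c\<^sub>0\<close> survives, so \<open>c\<^sub>0 \<in> Q\<^sub>1 \<inter> C \<subseteq> Q\<^sub>0\<close>; modulo the prime \<open>Q\<^sub>0\<close> one
  may then cancel a factor \<open>r\<close> and repeat. Thus every \<open>c\<^sub>i\<close>, and in particular \<open>1\<close>, lies in \<open>Q\<^sub>0\<close>.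
\<close>

lemma coefficients_in_prime:
  fixes R (structure) and m :: nat
  assumes "primeideal Q0 R" and "ideal Q1 R" and sub: "Q0 \<subseteq> Q1"
    and r: "r \<in> Q1" "r \<notin> Q0"
    and "\<And>i. i \<le> m \<Longrightarrow> a i \<in> carrier R"
    and "\<And>i. i \<le> m \<Longrightarrow> a i \<in> Q1 \<Longrightarrow> a i \<in> Q0"
    and "(\<Oplus>i\<in>{..m}. a i \<otimes> r [^] i) \<in> Q0"
    and "i \<le> m"
  shows "a i \<in> Q0"
  using assms(6-)
\<comment> \<open>The step shifts the coefficients, so \<open>a\<close> varies. Cancelling
  \<open>r\<close> yields only a sum in \<open>Q0\<close>, not a zero sum, which is why membership
  is what the induction carries.\<close>
proof (induction m arbitrary: a i)
  interpret Q0: primeideal Q0 R by fact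
  case 0
  then show ?case by simp
next
  interpret Q0: primeideal Q0 R by fact
  interpret Q1: ideal Q1 R by fact
  case (Suc m)
  have rc: "r \<in> carrier R" using r(1) by (rule Q1.Icarr)
  note a = Suc.prems(1)
  \<comment> \<open>Horner splitting: the full sum is \<open>a 0\<close> plus \<open>s\<close> times
    \<open>r\<close>.\<close>
  define s where "s = (\<Oplus>i\<in>{..m}. a (Suc i) \<otimes> r [^] i)"
  have s: "s \<in> carrier R"
    unfolding s_def using a rc by (intro Q0.finsum_closed) auto
  have "(\<Oplus>i\<in>{..m}. a (Suc i) \<otimes> r [^] Suc i) = (\<Oplus>i\<in>{..m}. (a (Suc i) \<otimes> r [^] i) \<otimes> r)"
    using a rc by (intro Q0.finsum_cong') (auto simp: Q0.m_assoc)
  also have "\<dots> = s \<otimes> r"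
    unfolding s_def using a rc by (intro Q0.finsum_ldistr[symmetric]) auto
  finally have split: "(\<Oplus>i\<in>{..Suc m}. a i \<otimes> r [^] i) = a 0 \<oplus> s \<otimes> r"
    using a rc by (subst Q0.finsum_Suc2) (auto simp: Q0.a_comm s)
  have sr1: "s \<otimes> r \<in> Q1" using r(1) s by (rule Q1.I_l_closed)
  have sum0: "a 0 \<oplus> s \<otimes> r \<in> Q0" using Suc.prems(3) split by simp
  \<comment> \<open>Both terms of this difference lie in \<open>Q1\<close>: the first through
    \<open>Q0\<close>, the second as a multiple of \<open>r\<close>.\<close>
  have "a 0 = (a 0 \<oplus> s \<otimes> r) \<ominus> s \<otimes> r"
    using s rc a[of 0] by (simp add: Q0.minus_eq Q0.a_assoc Q0.r_neg)
  then have "a 0 \<in> Q1"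
    using Q1.a_closed[OF subsetD[OF sub sum0] Q1.a_inv_closed[OF sr1]] by (metis Q0.minus_eq)
  then have a0: "a 0 \<in> Q0" using Suc.prems(2) by simp
  have "s \<otimes> r = \<ominus> a 0 \<oplus> (a 0 \<oplus> s \<otimes> r)"
    using s rc a[of 0] by (simp add: Q0.r_neg1)
  then have "s \<otimes> r \<in> Q0"
    using additive_subgroup.a_closed[OF Q0.additive_subgroup_axioms
        additive_subgroup.a_inv_closed[OF Q0.additive_subgroup_axioms a0] sum0] by metis
  \<comment> \<open>Primality of \<open>Q0\<close> cancels \<open>r\<close>, leaving a sum with one
    term fewer.\<close>
  then have "s \<in> Q0" using Q0.I_prime[OF s rc] r(2) by blast
  then have "a (Suc j) \<in> Q0" if "j \<le> m" for j
    using Suc.IH[of "\<lambda>i. a (Suc i)" j] Suc.prems(1,2) that by (simp add: s_def)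
  then show ?case using a0 Suc.prems(4) by (cases i) auto
qed

proposition quasi_integral_imp_INC:
  assumes "ring_extension C R" and "quasi_integral C R"
  shows "satisfies_INC C R"
  unfolding satisfies_INC_def
proof (intro allI impI, elim conjE)
  fix Q0 Q1
  assume Q0: "primeideal Q0 R" and Q1: "primeideal Q1 R" and "Q0 \<subset> Q1"
  interpret Q0: primeideal Q0 R by fact
  interpret Q1: primeideal Q1 R by fact
  have CR: "carrier C \<subseteq> carrier R" and one: "\<one>\<^bsub>C\<^esub> = \<one>\<^bsub>R\<^esub>"
    using assms(1) by (auto simp: ring_extension_def dest: ring_hom_one)
  obtain r where r: "r \<in> Q1" "r \<notin> Q0" using \<open>Q0 \<subset> Q1\<close> by blast
  obtain m :: nat and c i0 where c: "\<And>i. i \<le> m \<Longrightarrow> c i \<in> carrier C"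
    and zero: "(\<Oplus>\<^bsub>R\<^esub>i\<in>{..m}. c i \<otimes>\<^bsub>R\<^esub> r [^]\<^bsub>R\<^esub> i) = \<zero>\<^bsub>R\<^esub>"
    and i0: "i0 \<le> m" "c i0 = \<one>\<^bsub>C\<^esub>"
    using assms(2) Q1.Icarr[OF r(1)] unfolding quasi_integral_def by metis
  have "Q0 \<inter> carrier C \<noteq> Q1 \<inter> carrier C"
  proof
    assume eq: "Q0 \<inter> carrier C = Q1 \<inter> carrier C"
    have "c i0 \<in> Q0"
    proof (rule coefficients_in_prime[OF Q0 Q1.is_ideal _ r _ _ _ i0(1)])
      show "Q0 \<subseteq> Q1" using \<open>Q0 \<subset> Q1\<close> by blast
      show "c i \<in> carrier R" if "i \<le> m" for i using c[OF that] CR by blast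
      \<comment> \<open>Equality of the traces enters here, as the coefficients lie in
        \<open>C\<close>.\<close>
      show "c i \<in> Q0" if "i \<le> m" "c i \<in> Q1" for i using c[OF that(1)] that(2) eq by blast
    qed (simp add: zero)
    \<comment> \<open>The units of \<open>C\<close> and \<open>R\<close> agree, so \<open>Q0\<close>
      would contain the unit of \<open>R\<close>, yet a prime ideal is proper.\<close>
    then show False
      using i0(2) one Q0.one_imp_carrier Q0.I_notcarr by simp
  qed
  then show "Q0 \<inter> carrier C \<subset> Q1 \<inter> carrier C" using \<open>Q0 \<subset> Q1\<close> by blast
qed

theorem theorem3p7:
  fixes F :: "('a, 'm) ring_scheme" and R :: "('a, 'n) ring_scheme"
    and v :: "'a \<Rightarrow> 'g::linordered_ab_group_add extended"
  assumes "field F"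
    and "valuation F v"
    and "cring R"
    and "ring_extension (valuation_ring F v) R"
    and "quasi_integral (valuation_ring F v) R"
  shows "satisfies_INC (valuation_ring F v) R"
  using assms(4,5) by (rule quasi_integral_imp_INC)

end
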